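(* Let $F_k\in C^1(\Omega)$, $k=1,\dots,l$, with $\Delta(x^0)\neq0$, and let $y_1,\dots,y_{d-l}$ be the solutions, with values in $V$, of the iterated differential system $$\frac{\partial y_1}{\partial t_1}(t_1)=v_1(y_1(t_1)),\quad y_1(0)=x^0,$$ $$\frac{\partial y_j}{\partial t_j}(t_1,\dots,t_j)=v_j(y_j(t_1,\dots,t_j)),\quad y_j(t_1,\dots,t_{j-1},0)=y_{j-1}(t_1,\dots,t_{j-1}),\qquad j=2,\dots,d-l,$$ where $y_j$ is defined on $I_1\times\dots\times I_j$ and $I_1,\dots,I_{d-l}$ are closed intervals containing $0$ in their interior. If the intervals $I_j$, $j=1,\dots,d-l$, are sufficiently small, then the mapping $$y_{d-l}:I_1\times I_2\times\dots\times I_{d-l}\to\mathbb{R}^d$$ is regular (its Jacobian matrix has rank $d-l$ at every point) and one-to-one on its image.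
   Context: Setting: $1\le l\le d-1$ are integers, $\Omega\subset\mathbb{R}^d$ is a bounded domain, $x^0\in\Omega$, $F_1,\dots,F_l$ are real valued functions on $\Omega$ and $F_j(x^0)=0$ for $j=1,\dots,l$. Let $A(x)=\left(\frac{\partial F_i}{\partial x_j}(x)\right)_{1\le i,j\le l}$ and $\Delta(x)=\det A(x)$. When $\Delta(x^0)\ne0$, $V\subset\Omega$ denotes an open neighbourhood of $x^0$ on which $\Delta\neq 0$. Vector fields: for $s=1,\dots,d-l$ and $x\in V$, $v_s(x)\in\mathbb{R}^d$ is the unique vector with $v_s(x)\cdot\nabla F_j(x)=0$ for $j=1,\dots,l$ whose last $d-l$ components are the $s$-th row of the identity matrix of $\mathbb{R}^{d-l}$ multiplied by $\Delta(x)$ (the $(l+s)$-th component is $\Delta(x)$ and the other components with index in $\{l+1,\dots,d\}$ are $0$). Each subsystem is an ordinary differential system in $V$ in the variable $t_j$, with $t_1,\dots,t_{j-1}$ as parameters.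
   Formalization: For F_k merely C^1 the Jacobian matrix of y_{d-l} may fail to exist (e.g. F = x/(2+sqrt(x^2+y^2)) in R^3), so rank d-l is claimed at each point where y_{d-l} is differentiable, and at every point if the fields v_s are C^1 on V; injectivity is claimed in full. *)

theory Defs
  imports "HOL-Analysis.Analysis"
begin

text \<open>
  The space \<open>\<real>\<^sup>d\<close> is rendered as \<open>real ^ ('l + 'm)\<close> with \<open>CARD('l) = l \<ge> 1\<close> and
  \<open>CARD('m) = d - l \<ge> 1\<close>: the indices \<open>Inl j\<close> are the first \<open>l\<close> coordinates and the
  indices \<open>Inr s\<close> the last \<open>d - l\<close> ones.
\<close>

definition gradient :: "(real ^ 'n \<Rightarrow> real) \<Rightarrow> real ^ 'n \<Rightarrow> real ^ 'n"
  where "gradient f x = (\<chi> i. frechet_derivative f (at x) (axis i 1))"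

definition C1_on :: "(real ^ 'n \<Rightarrow> real) \<Rightarrow> (real ^ 'n) set \<Rightarrow> bool"
  where "C1_on f S \<longleftrightarrow> (\<forall>x\<in>S. f differentiable (at x)) \<and> continuous_on S (gradient f)"

definition A_mat :: "('l \<Rightarrow> real ^ ('l::finite + 'm::finite) \<Rightarrow> real)
    \<Rightarrow> real ^ ('l + 'm) \<Rightarrow> real ^ 'l ^ 'l"
  where "A_mat F x = (\<chi> i j. gradient (F i) x $ Inl j)"

definition Delta :: "('l \<Rightarrow> real ^ ('l::finite + 'm::finite) \<Rightarrow> real) \<Rightarrow> real ^ ('l + 'm) \<Rightarrow> real"
  where "Delta F x = det (A_mat F x)"

text \<open>The description is meaningful only where \<open>Delta F x \<noteq> 0\<close>.\<close>

definition vfield :: "('l \<Rightarrow> real ^ ('l::finite + 'm::finite) \<Rightarrow> real) \<Rightarrow> 'm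
    \<Rightarrow> real ^ ('l + 'm) \<Rightarrow> real ^ ('l + 'm)"
  where "vfield F s x = (THE w. (\<forall>j. w \<bullet> gradient (F j) x = 0) \<and>
                                (\<forall>i. w $ Inr i = (if i = s then Delta F x else 0)))"

text \<open>
  In the following, \<open>v j\<close> is the right-hand side of the \<open>j\<close>-th subsystem (\<open>1 \<le> j \<le> n\<close>),
  and the value \<open>y\<^sub>j (t\<^sub>1, \<dots>, t\<^sub>j)\<close> is \<open>y j [t\<^sub>1, \<dots>, t\<^sub>j]\<close>. The \<open>j\<close>-th unknown is only
  constrained on lists in \<open>I 1 \<times> \<dots> \<times> I j\<close>, and only its derivative in the last variable is
  assumed to exist. The derivative is one-sided at the end points of \<open>I j\<close>.
\<close>

definition iterated_solution ::
    "nat \<Rightarrow> (nat \<Rightarrow> 'a \<Rightarrow> 'a) \<Rightarrow> 'a set \<Rightarrow> 'a \<Rightarrow> (nat \<Rightarrow> real set)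
      \<Rightarrow> (nat \<Rightarrow> real list \<Rightarrow> 'a::real_normed_vector) \<Rightarrow> bool"
  where "iterated_solution n v V x0 I y \<longleftrightarrow>
    (\<forall>j\<in>{1..n}. \<forall>ts\<in>listset (map I [1..<j]).
       (\<forall>\<tau>\<in>I j. y j (ts @ [\<tau>]) \<in> V \<and>
          ((\<lambda>r. y j (ts @ [r])) has_vector_derivative v j (y j (ts @ [\<tau>]))) (at \<tau> within I j)) \<and>
       y j (ts @ [0]) = (if j = 1 then x0 else y (j - 1) ts))"

text \<open>
  An enumeration \<open>e\<close> of \<open>'m\<close> by \<open>1, \<dots>, CARD('m)\<close> turns a map of lists of length \<open>CARD('m)\<close>
  into a map on \<open>real ^ 'm\<close>.
\<close>

definition on_vec :: "(nat \<Rightarrow> 'm::finite) \<Rightarrow> (real list \<Rightarrow> 'a) \<Rightarrow> real ^ 'm \<Rightarrow> 'a"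
  where "on_vec e g t = g (map (\<lambda>j. t $ e j) [1..<Suc CARD('m)])"

definition box_of :: "(nat \<Rightarrow> 'm::finite) \<Rightarrow> (nat \<Rightarrow> real set) \<Rightarrow> (real ^ 'm) set"
  where "box_of e I = {t. \<forall>j\<in>{1..CARD('m)}. t $ e j \<in> I j}"

text \<open>
  \<open>B\<close> will be a box with nonempty interior, on which derivatives within \<open>B\<close> are unique, also
  at boundary points. Differentiability has to be part of the notion because
  \<^const>\<open>jacobian\<close> is unspecified for maps that are not differentiable.
\<close>

definition regular_at :: "(real ^ 'm \<Rightarrow> real ^ 'n) \<Rightarrow> (real ^ 'm) set \<Rightarrow> real ^ 'm \<Rightarrow> bool"
  where "regular_at f B t \<longleftrightarrow>
    f differentiable (at t within B) \<and> rank (jacobian f (at t within B)) = CARD('m)"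

end

theory Submission
  imports Defs
begin


text \<open>
  The coordinate of \<open>v\<^sub>s\<close> with index \<open>Inr i\<close> is \<open>\<Delta>\<close> for \<open>i = s\<close> and \<open>0\<close> otherwise, so the \<open>j\<close>-th
  subsystem moves only one of the last \<open>d - l\<close> coordinates, at speed \<open>\<Delta> \<noteq> 0\<close>. Hence that
  coordinate of the final map depends only on \<open>t\<^sub>1, \<dots>, t\<^sub>j\<close> and is strictly monotone in \<open>t\<^sub>j\<close>. This
  triangular structure gives injectivity, and also rank \<open>d - l\<close> wherever the map is differentiable.

  For differentiability when the fields are \<open>C\<^sup>1\<close>: each \<open>F\<^sub>k\<close> is constant along solutions, so for
  small intervals the solutions stay on a graph \<open>x = \<Phi> z\<close> over the last coordinates \<open>z\<close>. There each
  subsystem is the scalar separable equation \<open>\<zeta>' = h(\<dots>, \<zeta>, \<dots>)\<close> with \<open>h = \<Delta> \<circ> \<Phi>\<close>, and \<open>t\<^sub>j\<close> is the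
  integral of \<open>1 / h\<close>. Hence \<open>t = T z\<close> for an explicit \<open>C\<^sup>1\<close> map \<open>T\<close> whose derivative at the starting
  point is a nonzero multiple of the identity, and by the inverse function theorem the final map
  is \<open>\<Phi> \<circ> T\<^sup>-\<^sup>1\<close>, a composition of differentiable maps.
\<close>

section \<open>Calculus of \<open>C\<^sup>1\<close> functions\<close>

lemma C1_on_has_derivative:
  assumes "C1_on f S" "x \<in> S"
  shows "(f has_derivative (\<lambda>w. gradient f x \<bullet> w)) (at x)"
proof -
  have d: "(f has_derivative frechet_derivative f (at x)) (at x)"
    using assms by (auto simp: C1_on_def frechet_derivative_works)
  then have l: "linear (frechet_derivative f (at x))"
    using has_derivative_bounded_linear bounded_linear.linear by blast
  have "frechet_derivative f (at x) w = gradient f x \<bullet> w" for w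
  proof -
    have "frechet_derivative f (at x) w
        = frechet_derivative f (at x) (\<Sum>i\<in>UNIV. (w $ i) *\<^sub>R axis i 1)"
      using basis_expansion[of w] by (simp add: scalar_mult_eq_scaleR)
    also have "\<dots> = (\<Sum>i\<in>UNIV. (w $ i) * frechet_derivative f (at x) (axis i 1))"
      by (simp add: linear_sum[OF l] linear_scale[OF l])
    finally show ?thesis
      by (simp add: gradient_def inner_vec_def mult.commute)
  qed
  then have "frechet_derivative f (at x) = (\<lambda>w. gradient f x \<bullet> w)" by auto
  with d show ?thesis by simp
qed

lemma gradient_eqI:
  assumes "(f has_derivative (\<lambda>w. g \<bullet> w)) (at x)"
  shows "gradient f x = g"
  by (simp add: gradient_def vec_eq_iff inner_axis frechet_derivative_at[OF assms, symmetric])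

lemma C1_onI:
  assumes "\<And>x. x \<in> S \<Longrightarrow> (f has_derivative (\<lambda>w. g x \<bullet> w)) (at x)" and "continuous_on S g"
  shows "C1_on f S"
  using assms gradient_eqI[OF assms(1)]
  by (auto simp: C1_on_def differentiable_def cong: continuous_on_cong)

lemma C1_on_cong:
  assumes "open S" "C1_on f S" "\<And>x. x \<in> S \<Longrightarrow> f x = g x"
  shows "C1_on g S"
proof (rule C1_onI[where g = "gradient f"])
  show "(g has_derivative (\<lambda>w. gradient f x \<bullet> w)) (at x)" if "x \<in> S" for x
    using has_derivative_transform_within_open[OF C1_on_has_derivative[OF assms(2) that] assms(1) that]
      assms(3) by auto
qed (use assms(2) in \<open>auto simp: C1_on_def\<close>)

lemma C1_on_subset: "C1_on f S \<Longrightarrow> T \<subseteq> S \<Longrightarrow> C1_on f T"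
  by (auto simp: C1_on_def intro: continuous_on_subset)

lemma C1_on_continuous_on: "C1_on f S \<Longrightarrow> continuous_on S f"
  by (meson C1_on_def continuous_at_imp_continuous_on differentiable_imp_continuous_within)

lemma C1_on_coordinate: "C1_on (\<lambda>x. x $ i) S"
  by (rule C1_onI[where g = "\<lambda>_. axis i 1"])
    (auto simp: inner_axis' intro!: derivative_eq_intros bounded_linear_imp_has_derivative
      bounded_linear_vec_nth)

lemma C1_on_const: "C1_on (\<lambda>x. c) S"
  by (rule C1_onI[where g = "\<lambda>_. 0"]) auto

lemma has_derivative_vec_lambda:
  fixes f :: "'a::real_normed_vector \<Rightarrow> real ^ 'n"
  assumes "\<And>i. ((\<lambda>x. f x $ i) has_derivative (\<lambda>w. f' w $ i)) (at x within S)"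
  shows "(f has_derivative f') (at x within S)"
  unfolding has_derivative_componentwise_within[of f]
  using assms by (auto simp: Basis_vec_def inner_axis)

lemma C1_on_components_has_derivative:
  fixes p :: "real ^ 'n \<Rightarrow> real ^ 'k"
  assumes "\<And>i. C1_on (\<lambda>x. p x $ i) T" "x \<in> T"
  shows "(p has_derivative (\<lambda>w. \<chi> i. gradient (\<lambda>x. p x $ i) x \<bullet> w)) (at x)"
  by (rule has_derivative_vec_lambda) (simp add: C1_on_has_derivative[OF assms])

text \<open>\<open>C1_on\<close> concerns scalar functions, so the inner map enters through its
  coordinates. The chain rule writes the gradient as a combination of theirs, which makes its
  continuity visible.\<close>

lemma C1_on_compose:
  fixes p :: "real ^ 'n \<Rightarrow> real ^ 'k"
  assumes f: "C1_on f S" and p: "\<And>i. C1_on (\<lambda>x. p x $ i) T" and pT: "p ` T \<subseteq> S"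
  shows "C1_on (\<lambda>x. f (p x)) T"
proof (rule C1_onI[where g = "\<lambda>x. \<Sum>i\<in>UNIV. (gradient f (p x) $ i) *\<^sub>R gradient (\<lambda>x. p x $ i) x"])
  fix x assume x: "x \<in> T"
  have "(p has_derivative (\<lambda>w. \<chi> i. gradient (\<lambda>x. p x $ i) x \<bullet> w)) (at x)"
    by (rule C1_on_components_has_derivative[OF p x])
  moreover have "(f has_derivative (\<lambda>w. gradient f (p x) \<bullet> w)) (at (p x))"
    by (rule C1_on_has_derivative[OF f]) (use x pT in auto)
  ultimately have "((\<lambda>x. f (p x)) has_derivative
      (\<lambda>w. gradient f (p x) \<bullet> (\<chi> i. gradient (\<lambda>x. p x $ i) x \<bullet> w))) (at x)"
    by (rule has_derivative_compose)
  then show "((\<lambda>x. f (p x)) has_derivative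
      (\<lambda>w. (\<Sum>i\<in>UNIV. (gradient f (p x) $ i) *\<^sub>R gradient (\<lambda>x. p x $ i) x) \<bullet> w)) (at x)"
    by (simp add: inner_sum_left inner_vec_def[where 'b='k])
next
  have "continuous_on T p"
    using C1_on_continuous_on[OF p] by (auto simp: continuous_on_componentwise[of T p] Basis_vec_def inner_axis)
  then have "continuous_on T (\<lambda>x. gradient f (p x))"
    by (rule continuous_on_compose2[rotated]) (use f pT in \<open>auto simp: C1_on_def\<close>)
  then show "continuous_on T (\<lambda>x. \<Sum>i\<in>UNIV. (gradient f (p x) $ i) *\<^sub>R gradient (\<lambda>x. p x $ i) x)"
    using p by (intro continuous_intros) (auto simp: C1_on_def)
qed

lemma C1_on_inverse:
  assumes f: "C1_on f S" and nz: "\<And>x. x \<in> S \<Longrightarrow> f x \<noteq> 0"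
  shows "C1_on (\<lambda>x. inverse (f x)) S"
proof (rule C1_onI[where g = "\<lambda>x. (- (inverse (f x) * inverse (f x))) *\<^sub>R gradient f x"])
  fix x assume x: "x \<in> S"
  show "((\<lambda>x. inverse (f x)) has_derivative
     (\<lambda>w. (- (inverse (f x) * inverse (f x))) *\<^sub>R gradient f x \<bullet> w)) (at x)"
    by (rule derivative_eq_intros C1_on_has_derivative[OF f x] nz[OF x] ext)+ (simp)
next
  show "continuous_on S (\<lambda>x. (- (inverse (f x) * inverse (f x))) *\<^sub>R gradient f x)"
    using f nz C1_on_continuous_on[OF f] by (intro continuous_intros) (auto simp: C1_on_def)
qed

lemma C1_on_mult:
  assumes f: "C1_on f S" and g: "C1_on g S"
  shows "C1_on (\<lambda>x. f x * g x) S"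
proof (rule C1_onI[where g = "\<lambda>x. f x *\<^sub>R gradient g x + g x *\<^sub>R gradient f x"])
  fix x assume x: "x \<in> S"
  show "((\<lambda>x. f x * g x) has_derivative
     (\<lambda>w. (f x *\<^sub>R gradient g x + g x *\<^sub>R gradient f x) \<bullet> w)) (at x)"
    by (rule derivative_eq_intros C1_on_has_derivative[OF f x] C1_on_has_derivative[OF g x] ext)+
      (simp add: inner_add_left)
next
  show "continuous_on S (\<lambda>x. f x *\<^sub>R gradient g x + g x *\<^sub>R gradient f x)"
    using f g C1_on_continuous_on[OF f] C1_on_continuous_on[OF g]
    by (intro continuous_intros) (auto simp: C1_on_def)
qed

section \<open>Local inverses of C1 maps\<close>

lemma continuous_on_det:
  fixes A :: "'a::topological_space \<Rightarrow> real ^ 'n ^ 'n"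
  assumes "\<And>i j. continuous_on S (\<lambda>x. A x $ i $ j)"
  shows "continuous_on S (\<lambda>x. det (A x))"
  unfolding det_def by (intro continuous_intros assms)

text \<open>Invertibility of the derivative at \<open>x0\<close> is stated as a trivial kernel, the
  form in which it is verified for the level set and for the time map. That the inverse is again C1
  lets the graph of the level set be composed with \<open>Delta F\<close> later.\<close>

lemma C1_inverse_function:
  fixes f :: "real ^ 'n \<Rightarrow> real ^ 'n"
  assumes S: "open S" "x0 \<in> S" and f: "\<And>i. C1_on (\<lambda>x. f x $ i) S"
    and inj0: "\<And>w. \<forall>i. gradient (\<lambda>x. f x $ i) x0 \<bullet> w = 0 \<Longrightarrow> w = 0"
  obtains U W g where "open U" "x0 \<in> U" "U \<subseteq> S" "open W" "f x0 \<in> W" "homeomorphism U W f g"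
    "\<And>i. C1_on (\<lambda>x. g x $ i) W"
proof -
  define J where "J x = (\<chi> i. gradient (\<lambda>x. f x $ i) x)" for x
  have Jw: "(J x *v w) $ i = gradient (\<lambda>x. f x $ i) x \<bullet> w" for x w i
    by (simp add: J_def matrix_vector_mult_def inner_vec_def)
  define f' where "f' x = Blinfun ((*v) (J x))" for x
  have f'[simp]: "blinfun_apply (f' x) = (*v) (J x)" for x
    unfolding f'_def by (rule bounded_linear_Blinfun_apply) (rule matrix_vector_mul_bounded_linear)
  have gc: "continuous_on S (gradient (\<lambda>x. f x $ i))" for i
    using f by (auto simp: C1_on_def)
  have der: "(f has_derivative blinfun_apply (f' x)) (at x)" if "x \<in> S" for x
    by (rule has_derivative_vec_lambda) (simp add: Jw C1_on_has_derivative[OF f that])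
  have "continuous_on S (\<lambda>x. J x *v w)" for w
    unfolding J_def matrix_vector_mult_def
    by (intro continuous_intros) (use gc in auto)
  then have cont: "continuous_on S f'"
    by (intro continuous_on_blinfun_componentwise) simp
  have "J x0 *v w = 0 \<Longrightarrow> w = 0" for w
    using inj0[of w] Jw[of x0 w] by simp
  then obtain B where "B ** J x0 = mat 1"
    by (meson matrix_left_invertible_ker)
  then have inv: "Blinfun ((*v) B) o\<^sub>L f' x0 = id_blinfun"
    by (intro blinfun_eqI)
      (simp add: bounded_linear_Blinfun_apply matrix_vector_mul_bounded_linear matrix_vector_mul_assoc)
  obtain U W g g' where UW: "open U" "U \<subseteq> S" "x0 \<in> U" "open W" "f x0 \<in> W" "homeomorphism U W f g"
    and g: "\<And>y. y \<in> W \<Longrightarrow> (g has_derivative (g' y)) (at y)"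
    and g': "\<And>y. y \<in> W \<Longrightarrow> g' y = inv (blinfun_apply (f'(g y)))"
    and bij: "\<And>y. y \<in> W \<Longrightarrow> bij (blinfun_apply (f'(g y)))"
    using inverse_function_theorem[OF S(1) der cont S(2) inv] by metis
  have gS: "g ` W \<subseteq> S" and gcont: "continuous_on W g"
    using UW by (auto simp: homeomorphism_def)
  have det: "det (J (g y)) \<noteq> 0" if "y \<in> W" for y
    using bij[OF that] matrix_left_invertible_injective[of "J (g y)"]
    by (simp add: invertible_det_nz[symmetric] invertible_left_inverse bij_is_inj)
  \<comment> \<open>Cramer's rule makes the derivative of the inverse visibly continuous.\<close>
  define G where "G i y = (\<chi> k. det (\<chi> a b. if b = i then axis k 1 $ a else J (g y) $ a $ b) / det (J (g y)))"
    for i :: 'n and y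
  have "C1_on (\<lambda>y. g y $ i) W" for i
  proof (rule C1_onI[where g = "G i"])
    fix y assume y: "y \<in> W"
    have "linear (g' y)"
      using g[OF y] has_derivative_bounded_linear bounded_linear.linear by blast
    then have lin: "linear (\<lambda>w. g' y w $ i)"
      by (rule linear_compose[unfolded o_def]) (rule bounded_linear.linear[OF bounded_linear_vec_nth])
    have "g' y (axis k 1) $ i = G i y $ k" for k
    proof -
      have "J (g y) *v g' y (axis k 1) = axis k 1"
        using surj_f_inv_f[OF bij_is_surj[OF bij[OF y]], of "axis k 1"] g'[OF y] by simp
      then show ?thesis unfolding cramer[OF det[OF y]] by (simp add: G_def)
    qed
    then have "g' y w $ i = G i y \<bullet> w" for w
      using linear_sum[OF lin, of "\<lambda>i. (w $ i) *\<^sub>R axis i 1" UNIV] linear_scale[OF lin]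
        basis_expansion[of w]
      by (simp add: scalar_mult_eq_scaleR inner_vec_def mult.commute)
    then show "((\<lambda>y. g y $ i) has_derivative (\<lambda>w. G i y \<bullet> w)) (at y)"
      using bounded_linear.has_derivative[OF bounded_linear_vec_nth g[OF y], of i] by simp
  next
    have c: "continuous_on W (\<lambda>y. J (g y) $ a $ b)" for a b
      using continuous_on_compose2[OF gc gcont gS] 
      by (auto simp: J_def intro!: continuous_intros)
    show "continuous_on W (G i)"
      unfolding G_def
    proof (intro continuous_on_vec_lambda continuous_on_divide continuous_on_det)
      show "continuous_on W (\<lambda>x. (\<chi> a b. if b = i then axis k 1 $ a else J (g x) $ a $ b) $ p $ q)" for p q k
        by (cases "q = i") (auto simp: c)
    qed (auto simp: c det)
  qed
  with UW that show ?thesis by blast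
qed


section \<open>Scalar separable equations\<close>

text \<open>The integral of \<open>1 / \<phi>\<close> from \<open>\<zeta> 0\<close> to \<open>\<zeta> t\<close>, rescaled to \<open>{0..1}\<close> so that it can be
  differentiated with respect to the end point by the Leibniz rule.\<close>

lemma integral_reciprocal_speed:
  fixes \<zeta> \<phi> :: "real \<Rightarrow> real"
  assumes ab: "a < b" "0 \<in> {a..b}" "t \<in> {a..b}"
    and der: "\<And>r. r \<in> {a..b} \<Longrightarrow> (\<zeta> has_vector_derivative \<phi> (\<zeta> r)) (at r within {a..b})"
    and cont: "continuous_on (\<zeta> ` {a..b}) \<phi>" and nz: "\<And>r. r \<in> {a..b} \<Longrightarrow> \<phi> (\<zeta> r) \<noteq> 0"
  shows "(\<zeta> t - \<zeta> 0) * integral {0..1} (\<lambda>u. inverse (\<phi> (\<zeta> 0 + u * (\<zeta> t - \<zeta> 0)))) = t"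
proof -
  have "continuous_on {a..b} \<zeta>"
    using der by (rule continuous_on_vector_derivative)
  then obtain p q where pq: "\<zeta> ` {a..b} = {p..q}" "p \<le> q"
    using continuous_image_closed_interval[of a b \<zeta>] ab by auto
  have "continuous_on {p..q} (\<lambda>x. inverse (\<phi> x))"
    using cont nz unfolding pq(1)[symmetric] by (intro continuous_on_inverse) auto
  then obtain G where G: "\<And>x. x \<in> {p..q} \<Longrightarrow> (G has_vector_derivative inverse (\<phi> x)) (at x within {p..q})"
    using antiderivative_continuous by blast
  \<comment> \<open>\<open>G\<close> composed with \<open>\<zeta>\<close> has derivative 1, so it
    measures time up to a constant.\<close>
  have "((\<lambda>r. G (\<zeta> r) - r) has_vector_derivative 0) (at r within {a..b})" if r: "r \<in> {a..b}" for r
  proof -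
    have "(G has_vector_derivative inverse (\<phi> (\<zeta> r))) (at (\<zeta> r) within \<zeta> ` {a..b})"
      unfolding pq(1) by (rule G) (use r pq(1) in blast)
    from vector_diff_chain_within[OF der[OF r] this]
    have "((\<lambda>r. G (\<zeta> r)) has_vector_derivative 1) (at r within {a..b})"
      using nz[OF r] by (simp add: o_def)
    from has_vector_derivative_diff[OF this has_vector_derivative_id] show ?thesis by simp
  qed
  then obtain k where "\<And>r. r \<in> {a..b} \<Longrightarrow> G (\<zeta> r) - r = k"
    using has_vector_derivative_zero_constant[of "{a..b}" "\<lambda>r. G (\<zeta> r) - r"] by auto
  from this[OF ab(2)] this[OF ab(3)] have GG: "G (\<zeta> t) - G (\<zeta> 0) = t" by simp
  \<comment> \<open>The affine segment between the two end values stays in \<open>{p..q}\<close>;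
    this also covers \<open>\<zeta> t < \<zeta> 0\<close>.\<close>
  define l where "l u = \<zeta> 0 + u * (\<zeta> t - \<zeta> 0)" for u
  have lin: "l u \<in> {p..q}" if "u \<in> {0..1}" for u
  proof -
    have "\<zeta> 0 \<in> {p..q}" "\<zeta> t \<in> {p..q}"
      using ab(2,3) unfolding pq(1)[symmetric] by auto
    then have "closed_segment (\<zeta> 0) (\<zeta> t) \<subseteq> {p..q}"
      by (intro closed_segment_subset) auto
    moreover have "l u \<in> closed_segment (\<zeta> 0) (\<zeta> t)"
      using that unfolding closed_segment_def
      by (intro CollectI exI[of _ u]) (auto simp: l_def algebra_simps)
    ultimately show ?thesis by blast
  qed
  have "((\<lambda>u. G (l u)) has_vector_derivative (\<zeta> t - \<zeta> 0) * inverse (\<phi> (l u))) (at u within {0..1})"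
    if u: "u \<in> {0..1}" for u
  proof -
    have "(l has_vector_derivative (\<zeta> t - \<zeta> 0)) (at u within {0..1})"
      unfolding l_def by (auto intro!: derivative_eq_intros)
    moreover have "(G has_vector_derivative inverse (\<phi> (l u))) (at (l u) within l ` {0..1})"
      using has_vector_derivative_within_subset[OF G[OF lin[OF u]]] lin by blast
    ultimately show ?thesis
      using vector_diff_chain_within by (fastforce simp: o_def)
  qed
  then have "((\<lambda>u. (\<zeta> t - \<zeta> 0) * inverse (\<phi> (l u))) has_integral G (l 1) - G (l 0)) {0..1}"
    by (intro fundamental_theorem_of_calculus) auto
  then have "integral {0..1} (\<lambda>u. (\<zeta> t - \<zeta> 0) * inverse (\<phi> (l u))) = G (l 1) - G (l 0)"
    by (rule integral_unique)
  then show ?thesis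
    using GG by (simp add: l_def)
qed

section \<open>Parameter integrals and the time map\<close>

text \<open>Differentiation under the integral sign. Weights in \<open>{0..1}\<close> move no
  coordinate away from \<open>c\<close>, so \<open>g\<close> is evaluated inside the ball. Separate
  weights allow some coordinates to be frozen while another one runs.\<close>

lemma C1_on_integral_scaled:
  fixes g :: "real ^ 'm \<Rightarrow> real" and d :: "'m \<Rightarrow> real \<Rightarrow> real"
  assumes g: "C1_on g (ball c \<rho>)"
    and d: "\<And>i. continuous_on {0..1} (d i)" "\<And>i u. u \<in> {0..1} \<Longrightarrow> d i u \<in> {0..1}"
  shows "C1_on (\<lambda>z. integral {0..1} (\<lambda>u. g (\<chi> i. c $ i + d i u * (z $ i - c $ i)))) (ball c \<rho>)"
proof -
  define \<kappa> where "\<kappa> z u = (\<chi> i. c $ i + d i u * (z $ i - c $ i))" for z u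
  \<comment> \<open>The gradient of the integrand in \<open>z\<close>: the chain rule multiplies
    each component by its weight.\<close>
  define v where "v z u = (\<chi> i. d i u * gradient g (\<kappa> z u) $ i)" for z u
  have \<kappa>_ball: "\<kappa> z u \<in> ball c \<rho>" if "z \<in> ball c \<rho>" "u \<in> {0..1}" for z u
  proof -
    have "norm (\<kappa> z u - c) \<le> norm (z - c)"
      using d(2)[OF that(2)]
      by (intro norm_le_componentwise_cart) (auto simp: \<kappa>_def abs_mult intro!: mult_left_le_one_le)
    with that show ?thesis by (simp add: dist_norm norm_minus_commute)
  qed
  have dsnd: "continuous_on (A \<times> {0..1}) (\<lambda>p. d i (snd p))" for A :: "(real ^ 'm) set" and i
    by (rule continuous_on_compose2[OF d(1)]) (auto intro: continuous_intros)
  have \<kappa>_cont: "continuous_on (ball c \<rho> \<times> {0..1}) (\<lambda>p. \<kappa> (fst p) (snd p))"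
    unfolding \<kappa>_def by (intro continuous_intros dsnd)
  have g_cont: "continuous_on (ball c \<rho> \<times> {0..1}) (\<lambda>p. g (\<kappa> (fst p) (snd p)))"
    by (rule continuous_on_compose2[OF C1_on_continuous_on[OF g] \<kappa>_cont]) (use \<kappa>_ball in auto)
  have "continuous_on (ball c \<rho> \<times> {0..1}) (\<lambda>p. gradient g (\<kappa> (fst p) (snd p)))"
    by (rule continuous_on_compose2[OF _ \<kappa>_cont]) (use g \<kappa>_ball in \<open>auto simp: C1_on_def\<close>)
  then have v_cont: "continuous_on (ball c \<rho> \<times> {0..1}) (\<lambda>p. v (fst p) (snd p))"
    unfolding v_def by (intro continuous_intros dsnd)
  have sect: "continuous_on {0..1} (\<lambda>u. f z u)"
    if "continuous_on (ball c \<rho> \<times> {0..1}) (\<lambda>p. f (fst p) (snd p))" "z \<in> ball c \<rho>"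
    for f :: "real ^ 'm \<Rightarrow> real \<Rightarrow> 'b::topological_space" and z
  proof -
    have "continuous_on {0..1} (\<lambda>u. f (fst (z, u)) (snd (z, u)))"
      by (rule continuous_on_compose2[OF that(1)]) (use that(2) in \<open>auto intro: continuous_intros\<close>)
    then show ?thesis by simp
  qed
  have der: "((\<lambda>z. g (\<kappa> z u)) has_derivative blinfun_apply (blinfun_inner_right (v z u)))
      (at z within ball c \<rho>)" if "z \<in> ball c \<rho>" "u \<in> {0..1}" for z u
  proof -
    have "((\<lambda>z. \<kappa> z u) has_derivative (\<lambda>w. \<chi> i. d i u * w $ i)) (at z within ball c \<rho>)"
      unfolding \<kappa>_def
      by (rule has_derivative_vec_lambda)
        (auto intro!: derivative_eq_intros bounded_linear_imp_has_derivative bounded_linear_vec_nth)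
    from has_derivative_compose[OF this C1_on_has_derivative[OF g \<kappa>_ball[OF that]]]
    moreover have "gradient g (\<kappa> z u) \<bullet> (\<chi> i. d i u * w $ i) = v z u \<bullet> w" for w
      by (simp add: v_def inner_vec_def mult_ac)
    ultimately show ?thesis by simp
  qed
  show ?thesis
    unfolding \<kappa>_def[symmetric]
  proof (rule C1_onI[where g = "\<lambda>z. integral {0..1} (v z)"])
    fix z assume z: "z \<in> ball c \<rho>"
    have "((\<lambda>z. integral (cbox 0 1) (\<lambda>u. g (\<kappa> z u))) has_derivative
        blinfun_apply (integral (cbox 0 1) (\<lambda>u. blinfun_inner_right (v z u)))) (at z within ball c \<rho>)"
    proof (rule leibniz_rule[OF _ _ _ z convex_ball])
      show "continuous_on (ball c \<rho> \<times> cbox 0 1) (\<lambda>(z, u). blinfun_inner_right (v z u))"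
        using bounded_linear.continuous_on[OF bounded_linear_blinfun_inner_right v_cont]
        by (simp add: case_prod_beta)
      show "(\<lambda>u. g (\<kappa> z u)) integrable_on cbox 0 1" if "z \<in> ball c \<rho>" for z
        by (rule integrable_continuous) (use sect[OF g_cont that] in simp)
    qed (use der in simp)
    moreover have "integral {0..1} (\<lambda>u. blinfun_inner_right (v z u)) = blinfun_inner_right (integral {0..1} (v z))"
      using integral_linear[OF integrable_continuous_interval[OF sect[OF v_cont z]]
        bounded_linear_blinfun_inner_right]
      by (simp add: o_def)
    ultimately show "((\<lambda>z. integral {0..1} (\<lambda>u. g (\<kappa> z u))) has_derivative
        (\<lambda>w. integral {0..1} (v z) \<bullet> w)) (at z)"
      using z by (simp add: at_within_open[OF z])
  next
    show "continuous_on (ball c \<rho>) (\<lambda>z. integral {0..1} (v z))"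
      using integral_continuous_on_param[of "ball c \<rho>" 0 1 v] v_cont by (simp add: case_prod_beta)
  qed
qed

text \<open>Each coordinate of \<open>T c\<close> is a factor vanishing at \<open>c\<close> times a
  C1 integral. The product rule leaves only the derivative of that factor, so the derivative at
  \<open>c\<close> is \<open>inverse (h c)\<close> times the identity, whatever the weights
  are.\<close>

lemma time_map_local_inverse:
  fixes h :: "real ^ 'm \<Rightarrow> real" and d :: "'m \<Rightarrow> 'm \<Rightarrow> real \<Rightarrow> real"
  defines "T \<equiv> \<lambda>c z. \<chi> s. (z $ s - c $ s) *
    integral {0..1} (\<lambda>u. inverse (h (\<chi> i. c $ i + d s i u * (z $ i - c $ i))))"
  assumes h: "C1_on h (ball c \<rho>)" "\<And>z. z \<in> ball c \<rho> \<Longrightarrow> h z \<noteq> 0" and \<rho>: "\<rho> > 0"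
    and d: "\<And>s i. continuous_on {0..1} (d s i)" "\<And>s i u. u \<in> {0..1} \<Longrightarrow> d s i u \<in> {0..1}"
  obtains N Q S where "open N" "c \<in> N" "N \<subseteq> ball c \<rho>" "open Q"
    "\<forall>z\<in>N. T c z \<in> Q \<and> S (T c z) = z" "\<And>i. C1_on (\<lambda>t. S t $ i) Q"
proof -
  define q where "q s z = integral {0..1} (\<lambda>u. inverse (h (\<chi> i. c $ i + d s i u * (z $ i - c $ i))))" for s z
  have q: "C1_on (q s) (ball c \<rho>)" for s
    unfolding q_def by (rule C1_on_integral_scaled) (use d in \<open>auto intro: C1_on_inverse[OF h]\<close>)
  have T: "T c z $ s = (z $ s - c $ s) * q s z" for s z
    by (simp add: T_def q_def)
  have "C1_on (\<lambda>z. z $ s - c $ s) (ball c \<rho>)" for s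
    by (rule C1_onI[where g = "\<lambda>_. axis s 1"])
      (auto simp: inner_axis' intro!: derivative_eq_intros bounded_linear_imp_has_derivative
        bounded_linear_vec_nth)
  then have T_C1: "C1_on (\<lambda>z. T c z $ s) (ball c \<rho>)" for s
    unfolding T by (rule C1_on_mult[OF _ q])
  have c: "c \<in> ball c \<rho>" using \<rho> by simp
  have grad: "gradient (\<lambda>z. T c z $ s) c = inverse (h c) *\<^sub>R axis s 1" for s
  proof (rule gradient_eqI)
    have "q s c = inverse (h c)"
      by (simp add: q_def vec_lambda_eta)
    moreover have "((\<lambda>z. z $ s - c $ s) has_derivative (\<lambda>w. w $ s)) (at c)"
      using has_derivative_diff[OF bounded_linear_imp_has_derivative[OF bounded_linear_vec_nth[of s]]
          has_derivative_const[of "c $ s"]] by simp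
    from has_derivative_mult[OF this C1_on_has_derivative[OF q c]]
    have "((\<lambda>z. (z $ s - c $ s) * q s z) has_derivative (\<lambda>w. w $ s * q s c)) (at c)"
      by simp
    ultimately show "((\<lambda>z. T c z $ s) has_derivative (\<lambda>w. (inverse (h c) *\<^sub>R axis s 1) \<bullet> w)) (at c)"
      unfolding T by (simp add: inner_axis' mult.commute)
  qed
  have inj: "w = 0" if "\<forall>s. gradient (\<lambda>z. T c z $ s) c \<bullet> w = 0" for w
    using that h(2)[OF c] by (simp add: grad inner_axis' vec_eq_iff)
  obtain N Q S where NQ: "open N" "c \<in> N" "N \<subseteq> ball c \<rho>" "open Q" "T c c \<in> Q"
    "homeomorphism N Q (T c) S" "\<And>i. C1_on (\<lambda>t. S t $ i) Q"
    by (rule C1_inverse_function[OF open_ball c T_C1 inj]) (assumption, rule that)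
  show ?thesis
    using that[OF NQ(1-4) _ NQ(7)] NQ(6) by (auto simp: homeomorphism_def)
qed

section \<open>The vector fields and the level set\<close>

abbreviation tail :: "real ^ ('l::finite + 'm::finite) \<Rightarrow> real ^ 'm"
  where "tail x \<equiv> \<chi> s. x $ Inr s"

lemma inner_sum_index:
  fixes w x :: "real ^ ('l::finite + 'm::finite)"
  shows "w \<bullet> x = (\<Sum>j\<in>UNIV. w $ Inl j * x $ Inl j) + (\<Sum>s\<in>UNIV. w $ Inr s * x $ Inr s)"
  by (simp add: inner_vec_def UNIV_Plus_UNIV[symmetric] sum.Plus del: UNIV_Plus_UNIV)

text \<open>Once the last components are prescribed, orthogonality to the gradients is a square
  linear system for the first ones with matrix \<open>A_mat F x\<close>. Cramer's rule gives exactly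
  one solution, so the definite description denotes it.\<close>

lemma vfield_spec:
  fixes F :: "'l \<Rightarrow> real ^ ('l::finite + 'm::finite) \<Rightarrow> real"
  assumes nz: "Delta F x \<noteq> 0"
  shows "vfield F s x \<bullet> gradient (F j) x = 0"
    and "vfield F s x $ Inr i = (if i = s then Delta F x else 0)"
proof -
  define b where "b = (\<chi> j. - Delta F x * gradient (F j) x $ Inr s)"
  have det: "det (A_mat F x) \<noteq> 0" using nz by (simp add: Delta_def)
  have *: "(\<forall>j. w \<bullet> gradient (F j) x = 0) \<longleftrightarrow> A_mat F x *v (\<chi> i. w $ Inl i) = b"
    if "\<forall>i. w $ Inr i = (if i = s then Delta F x else 0)" for w
  proof -
    have "(\<Sum>i\<in>UNIV. w $ Inr i * v $ Inr i) = (\<Sum>i\<in>UNIV. if i = s then Delta F x * v $ Inr i else 0)"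
      for v :: "real ^ ('l + 'm)"
      using that by (intro sum.cong) auto
    then have "w \<bullet> v = (\<Sum>i\<in>UNIV. w $ Inl i * v $ Inl i) + Delta F x * v $ Inr s"
      for v :: "real ^ ('l + 'm)"
      by (simp add: inner_sum_index)
    moreover have "(A_mat F x *v (\<chi> i. w $ Inl i)) $ j = (\<Sum>i\<in>UNIV. w $ Inl i * gradient (F j) x $ Inl i)"
      for j
      by (simp add: A_mat_def matrix_vector_mult_def mult.commute)
    ultimately show ?thesis
      by (simp add: b_def vec_eq_iff eq_neg_iff_add_eq_0)
  qed
  have "\<exists>!w. (\<forall>j. w \<bullet> gradient (F j) x = 0) \<and>
      (\<forall>i. w $ Inr i = (if i = s then Delta F x else 0))" (is "\<exists>!w. ?P w")
  proof -
    define a where "a = (\<chi> k. det (\<chi> i j. if j = k then b $ i else A_mat F x $ i $ j) / det (A_mat F x))"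
    have a: "A_mat F x *v v = b \<longleftrightarrow> v = a" for v
      unfolding a_def by (rule cramer[OF det])
    let ?w = "\<chi> i. case i of Inl k \<Rightarrow> a $ k | Inr i \<Rightarrow> if i = s then Delta F x else 0"
    have "?P ?w" using *[of ?w] a by (simp add: vec_lambda_eta)
    moreover have "w = ?w" if "?P w" for w
    proof -
      have "(\<chi> i. w $ Inl i) = a" using that * a by blast
      then show ?thesis using that by (auto simp: vec_eq_iff split: sum.split)
    qed
    ultimately show ?thesis by blast
  qed
  from theI'[OF this]
  show "vfield F s x \<bullet> gradient (F j) x = 0"
    and "vfield F s x $ Inr i = (if i = s then Delta F x else 0)"
    unfolding vfield_def by blast+
qed

text \<open>The implicit function theorem, deduced from the inverse function theorem for the map
  \<open>G\<close> that replaces the first coordinates by the values of \<open>F\<close> and keeps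
  the tail.\<close>

lemma level_set_graph:
  fixes F :: "'l \<Rightarrow> real ^ ('l::finite + 'm::finite) \<Rightarrow> real"
  assumes V: "open V" "x0 \<in> V" and F: "\<And>k. C1_on (F k) V" "\<And>k. F k x0 = 0"
    and nz: "Delta F x0 \<noteq> 0"
  obtains U W \<Phi> where "open U" "x0 \<in> U" "open W" "tail x0 \<in> W" "\<Phi> ` W \<subseteq> V"
    "\<And>x. x \<in> U \<Longrightarrow> \<forall>k. F k x = 0 \<Longrightarrow> \<Phi> (tail x) = x"
    "\<And>i. C1_on (\<lambda>z. \<Phi> z $ i) W"
proof -
  define G where "G x = (\<chi> i. case i of Inl k \<Rightarrow> F k x | Inr s \<Rightarrow> x $ Inr s)" for x
  have G: "(\<lambda>x. G x $ Inl k) = F k" "(\<lambda>x. G x $ Inr s) = (\<lambda>x. x $ Inr s)" for k s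
    by (simp_all add: G_def fun_eq_iff)
  have G_C1: "C1_on (\<lambda>x. G x $ i) V" for i
    by (cases i) (simp_all add: G F C1_on_coordinate)
  have inj: "w = 0" if w: "\<forall>i. gradient (\<lambda>x. G x $ i) x0 \<bullet> w = 0" for w
  proof -
    have "gradient (\<lambda>x. x $ Inr s) x0 = axis (Inr s) 1" for s :: 'm
      by (rule gradient_eqI)
        (auto simp: inner_axis' intro!: bounded_linear_imp_has_derivative bounded_linear_vec_nth)
    then have r: "w $ Inr s = 0" for s
      using w[rule_format, of "Inr s"] by (simp add: G inner_axis')
    \<comment> \<open>With the tail of \<open>w\<close> zero, the remaining rows of the derivative
      reduce to \<open>A_mat F x0\<close>.\<close>
    have "A_mat F x0 *v (\<chi> i. w $ Inl i) = 0"
      using w[rule_format, of "Inl _"] by (simp add: G inner_sum_index r vec_eq_iff A_mat_def matrix_vector_mult_def)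
    then have "(\<chi> i. w $ Inl i) = 0"
      using nz matrix_left_invertible_ker[of "A_mat F x0"]
      by (simp add: Delta_def invertible_det_nz[symmetric] invertible_left_inverse)
    then have "w $ i = 0" for i
      using r by (cases i) (auto simp: vec_eq_iff)
    then show ?thesis by (simp add: vec_eq_iff)
  qed
  obtain U Q H where U: "open U" "x0 \<in> U" "U \<subseteq> V" "open Q" "G x0 \<in> Q" "homeomorphism U Q G H"
    and H: "\<And>i. C1_on (\<lambda>x. H x $ i) Q"
    by (rule C1_inverse_function[OF V G_C1 inj]) (assumption, rule that)
  \<comment> \<open>\<open>E\<close> inserts zero for the values of \<open>F\<close>, so the inverse
    of \<open>G\<close> after \<open>E\<close> parametrises the level set by the tail.\<close>
  define E :: "real ^ 'm \<Rightarrow> real ^ ('l + 'm)"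
    where "E z = (\<chi> i. case i of Inl k \<Rightarrow> 0 | Inr s \<Rightarrow> z $ s)" for z
  have E: "(\<lambda>z. E z $ Inl k) = (\<lambda>z. 0)" "(\<lambda>z. E z $ Inr s) = (\<lambda>z. z $ s)" for k s
    by (simp_all add: E_def fun_eq_iff)
  have E_C1: "C1_on (\<lambda>z. E z $ i) S" for i S
    by (cases i) (simp_all add: E C1_on_coordinate C1_on_const)
  have E_tail: "E (tail x) = G x" if "\<And>k. F k x = 0" for x
    using that by (auto simp: E_def G_def vec_eq_iff split: sum.split)
  show ?thesis
  proof
    have "continuous_on UNIV E"
      using C1_on_continuous_on[OF E_C1] by (auto simp: continuous_on_componentwise[of _ E] Basis_vec_def inner_axis)
    then show "open (E -` Q)"
      using U(4) by (simp add: continuous_on_open_vimage)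
    show "tail x0 \<in> E -` Q"
      using U E_tail F(2) by simp
    show "(\<lambda>z. H (E z)) ` (E -` Q) \<subseteq> V"
      using U by (auto simp: homeomorphism_def)
    show "H (E (tail x)) = x" if "x \<in> U" "\<forall>k. F k x = 0" for x
      using U that E_tail by (auto simp: homeomorphism_def)
    show "C1_on (\<lambda>z. H (E z) $ i) (E -` Q)" for i
      by (rule C1_on_compose[OF H E_C1]) auto
  qed (use U in auto)
qed


section \<open>A priori bound for curves\<close>

text \<open>The speed is controlled only inside the ball. As a displacement of \<open>M\<close> does
  not reach distance \<open>R\<close>, the curve cannot leave the region where the control
  holds.\<close>

lemma norm_growth_within_ball:
  fixes q :: "real \<Rightarrow> 'a::real_normed_vector"
  assumes der: "\<And>s. s \<in> {0..1} \<Longrightarrow> (q has_vector_derivative q' s) (at s within {0..1})"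
    and bound: "\<And>s. s \<in> {0..1} \<Longrightarrow> q s \<in> ball c R \<Longrightarrow> norm (q' s) \<le> M"
    and M: "0 \<le> M" "dist c (q 0) + M < R"
  shows "dist c (q 1) \<le> dist c (q 0) + M"
proof -
  have cont: "continuous_on {0..1} q"
    using der by (rule continuous_on_vector_derivative)
  \<comment> \<open>Only times strictly before \<open>s\<close> have to lie in the ball, so the
    estimate also applies at a first exit time.\<close>
  have growth: "dist c (q s) \<le> dist c (q 0) + M"
    if s: "s \<in> {0..1}" and inside: "\<And>r. 0 < r \<Longrightarrow> r < s \<Longrightarrow> q r \<in> ball c R" for s
  proof (cases "s = 0")
    case False
    have "norm (q s - q 0) \<le> M * s - M * 0"
    proof (rule differentiable_bound_general[where f' = q' and \<phi>' = "\<lambda>_. M"])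
      show "0 < s" using s False by simp
      show "continuous_on {0..s} q" using cont s by (auto intro: continuous_on_subset)
      show "continuous_on {0..s} ((*) M)" by (intro continuous_intros)
      fix r assume r: "0 < r" "r < s"
      then have "r \<in> {0<..<1}" using s by auto
      moreover from this have "(q has_vector_derivative q' r) (at r within {0<..<1})"
        by (intro has_vector_derivative_within_subset[OF der]) auto
      ultimately show "(q has_vector_derivative q' r) (at r)"
        using at_within_open[of r "{0<..<1}"] by simp
      show "((*) M has_vector_derivative M) (at r)"
        using has_vector_derivative_mult_right[OF has_vector_derivative_id, of M] by simp
      show "norm (q' r) \<le> M"
        using bound[of r] inside r s by auto
    qed
    moreover have "M * s \<le> M" using M s by (simp add: mult_left_le)
    moreover have "dist c (q s) \<le> dist c (q 0) + dist (q 0) (q s)" by (rule dist_triangle)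
    ultimately show ?thesis by (simp add: dist_norm norm_minus_commute)
  qed (use M in simp)
  define E where "E = {0..1} \<inter> (\<lambda>s. dist c (q s)) -` {R..}"
  \<comment> \<open>The first exit time would contradict the bound that holds up to it.\<close>
  have "E = {}"
  proof (rule ccontr)
    assume ne: "E \<noteq> {}"
    have "closed E"
      unfolding E_def by (intro continuous_closed_preimage continuous_intros cont)
    moreover have "bounded E" by (rule bounded_subset[of "{0..1}"]) (auto simp: E_def)
    ultimately have "compact E" by (simp add: compact_eq_bounded_closed)
    from compact_attains_inf[OF this ne]
    obtain s where s: "s \<in> E" "\<And>r. r \<in> E \<Longrightarrow> s \<le> r" by auto
    have "dist c (q s) \<le> dist c (q 0) + M"
    proof (rule growth)
      show "q r \<in> ball c R" if "0 < r" "r < s" for r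
        using that s(2)[of r] s(1) by (force simp: E_def)
    qed (use s in \<open>simp add: E_def\<close>)
    with M s show False by (simp add: E_def)
  qed
  then have "q s \<in> ball c R" if "s \<in> {0..1}" for s
    using that by (force simp: E_def)
  then show ?thesis by (intro growth) auto
qed

section \<open>Solutions of the iterated system\<close>

text \<open>Varying one entry of the time vector turns the derivative in the last list entry into a
  derivative along a coordinate line.\<close>

definition upd :: "real ^ 'm \<Rightarrow> 'm \<Rightarrow> real \<Rightarrow> real ^ 'm"
  where "upd t k r = (\<chi> i. if i = k then r else t $ i)"

lemma upd_simps [simp]:
  "upd t k r $ k = r" "i \<noteq> k \<Longrightarrow> upd t k r $ i = t $ i"
  "upd (upd t k r) k r' = upd t k r'" "upd t k (t $ k) = t"
  by (auto simp: upd_def vec_eq_iff)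

lemma upd_has_vector_derivative:
  "((\<lambda>r. upd t k r) has_vector_derivative axis k 1) (at r within S)"
proof -
  have "((\<lambda>r. upd t k 0 + r *\<^sub>R axis k 1) has_vector_derivative axis k 1) (at r within S)"
    by (auto intro!: derivative_eq_intros)
  also have "(\<lambda>r. upd t k 0 + r *\<^sub>R axis k 1) = upd t k"
    by (auto simp: upd_def axis_def vec_eq_iff)
  finally show ?thesis .
qed

lemma map_in_listset: "(\<And>x. x \<in> set xs \<Longrightarrow> g x \<in> I x) \<Longrightarrow> map g xs \<in> listset (map I xs)"
  by (induction xs) (auto simp: set_Cons_def)

locale iterated_solution_box =
  fixes F :: "'l \<Rightarrow> real ^ ('l::finite + 'm::finite) \<Rightarrow> real"
    and V :: "(real ^ ('l + 'm)) set" and x0 :: "real ^ ('l + 'm)"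
    and e :: "nat \<Rightarrow> 'm" and a b :: "nat \<Rightarrow> real"
    and y :: "nat \<Rightarrow> real list \<Rightarrow> real ^ ('l + 'm)"
  assumes e: "bij_betw e {1..CARD('m)} UNIV"
    and ab: "\<And>j. j \<in> {1..CARD('m)} \<Longrightarrow> a j < 0 \<and> 0 < b j"
    and Delta_nonzero: "\<And>x. x \<in> V \<Longrightarrow> Delta F x \<noteq> 0"
    and sol: "iterated_solution CARD('m) (\<lambda>j. vfield F (e j)) V x0 (\<lambda>j. {a j..b j}) y"
begin

text \<open>Every stage is read as a function of the full time vector, so that all stages have one
  type. Stage 0 is the constant \<open>x0\<close>, which makes the initial condition uniform in
  \<open>j\<close>.\<close>

definition Y :: "nat \<Rightarrow> real ^ 'm \<Rightarrow> real ^ ('l + 'm)"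
  where "Y j t = (if j = 0 then x0 else y j (map (\<lambda>i. t $ e i) [1..<Suc j]))"

abbreviation box :: "(real ^ 'm) set"
  where "box \<equiv> box_of e (\<lambda>j. {a j..b j})"

lemma on_vec_eq_Y: "on_vec e (y CARD('m)) = Y CARD('m)"
  by (simp add: on_vec_def Y_def fun_eq_iff)

lemma e_eq_iff: "i \<in> {1..CARD('m)} \<Longrightarrow> j \<in> {1..CARD('m)} \<Longrightarrow> e i = e j \<longleftrightarrow> i = j"
  using e by (auto simp: bij_betw_def inj_on_eq_iff)

lemma obtain_index: obtains i where "i \<in> {1..CARD('m)}" "s = e i"
  using e by (metis UNIV_I bij_betw_imp_surj_on imageE)

lemma box_coord: "t \<in> box \<Longrightarrow> j \<in> {1..CARD('m)} \<Longrightarrow> t $ e j \<in> {a j..b j}"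
  by (auto simp: box_of_def)

lemma upd_in_box:
  assumes "t \<in> box" "j \<in> {1..CARD('m)}" "r \<in> {a j..b j}"
  shows "upd t (e j) r \<in> box"
proof -
  have "upd t (e j) r $ e i \<in> {a i..b i}" if "i \<in> {1..CARD('m)}" for i
    using assms that e_eq_iff[OF that assms(2)] box_coord[OF assms(1) that]
    by (cases "i = j") auto
  then show ?thesis by (auto simp: box_of_def)
qed

lemma Y_prefix:
  assumes "\<And>i. i \<in> {1..j} \<Longrightarrow> t $ e i = t' $ e i"
  shows "Y j t = Y j t'"
  using assms by (auto simp: Y_def simp del: upt_Suc intro!: arg_cong[where f = "y j"])

text \<open>Changing entry \<open>e j\<close> leaves the list of the first \<open>j - 1\<close>
  times fixed, so the list formulation of the system carries over to \<open>Y\<close>.\<close>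

lemma Y_sol:
  assumes t: "t \<in> box" and j: "j \<in> {1..CARD('m)}"
  shows Y_in_V: "Y j t \<in> V"
    and Y_vector_derivative: "((\<lambda>r. Y j (upd t (e j) r)) has_vector_derivative vfield F (e j) (Y j t))
      (at (t $ e j) within {a j..b j})"
    and Y_zero: "Y j (upd t (e j) 0) = Y (j - 1) t"
proof -
  define ts where "ts = map (\<lambda>i. t $ e i) [1..<j]"
  have ts: "ts \<in> listset (map (\<lambda>j. {a j..b j}) [1..<j])"
    unfolding ts_def by (rule map_in_listset) (use box_coord[OF t] j in auto)
  have "map (\<lambda>i. upd t (e j) r $ e i) [1..<j] = ts" for r
    unfolding ts_def using j by (auto simp: e_eq_iff)
  then have Yr: "Y j (upd t (e j) r) = y j (ts @ [r])" for r
    using j by (simp add: Y_def)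
  from Yr[of "t $ e j"] have Yt: "Y j t = y j (ts @ [t $ e j])" by simp
  have S: "(\<forall>\<tau>\<in>{a j..b j}. y j (ts @ [\<tau>]) \<in> V \<and>
      ((\<lambda>r. y j (ts @ [r])) has_vector_derivative vfield F (e j) (y j (ts @ [\<tau>]))) (at \<tau> within {a j..b j})) \<and>
       y j (ts @ [0]) = (if j = 1 then x0 else y (j - 1) ts)"
    using sol j ts unfolding iterated_solution_def by blast
  show "Y j t \<in> V"
    and "((\<lambda>r. Y j (upd t (e j) r)) has_vector_derivative vfield F (e j) (Y j t))
      (at (t $ e j) within {a j..b j})"
    unfolding Yr using S box_coord[OF t j] Yt by auto
  have "Y (j - 1) t = (if j = 1 then x0 else y (j - 1) ts)"
    using j by (auto simp: Y_def ts_def)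
  then show "Y j (upd t (e j) 0) = Y (j - 1) t"
    unfolding Yr using S by simp
qed

lemma Y_path_derivative:
  assumes "t \<in> box" "j \<in> {1..CARD('m)}" "r \<in> {a j..b j}"
  shows "((\<lambda>r. Y j (upd t (e j) r)) has_vector_derivative vfield F (e j) (Y j (upd t (e j) r)))
      (at r within {a j..b j})"
  using Y_vector_derivative[OF upd_in_box[OF assms] assms(2)] by simp

lemma tail_path_derivative:
  assumes "t \<in> box" "j \<in> {1..CARD('m)}" "r \<in> {a j..b j}"
  shows "((\<lambda>r. Y j (upd t (e j) r) $ Inr s) has_vector_derivative
      (if s = e j then Delta F (Y j (upd t (e j) r)) else 0)) (at r within {a j..b j})"
  using bounded_linear.has_vector_derivative[OF bounded_linear_vec_nth Y_path_derivative[OF assms], of "Inr s"]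
    vfield_spec(2)[OF Delta_nonzero[OF Y_in_V[OF upd_in_box[OF assms] assms(2)]]]
  by simp

text \<open>Along stage \<open>j\<close> this coordinate has derivative zero, so it equals its value
  at time 0, where stage \<open>j - 1\<close> ended.\<close>

lemma tail_step:
  assumes t: "t \<in> box" and j: "j \<in> {1..CARD('m)}" and s: "s \<noteq> e j"
  shows "Y j t $ Inr s = Y (j - 1) t $ Inr s"
proof -
  obtain k where "\<And>r. r \<in> {a j..b j} \<Longrightarrow> Y j (upd t (e j) r) $ Inr s = k"
    using has_vector_derivative_zero_constant[of "{a j..b j}" "\<lambda>r. Y j (upd t (e j) r) $ Inr s"]
      tail_path_derivative[OF t j, of _ s] s by auto
  from this[of 0] this[of "t $ e j"] show ?thesis
    using box_coord[OF t j] ab[OF j] by (simp add: Y_zero[OF t j])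
qed

text \<open>Iterates \<open>tail_step\<close>, as does \<open>tail_stable\<close>: together they say
  that coordinate \<open>e i\<close> moves only in stage \<open>i\<close>.\<close>

lemma tail_initial:
  assumes t: "t \<in> box" and "i \<in> {1..CARD('m)}" "j < i"
  shows "Y j t $ Inr (e i) = x0 $ Inr (e i)"
  using assms(3)
proof (induction j)
  case (Suc j)
  then show ?case
    using tail_step[OF t, of "Suc j" "e i"] e_eq_iff[of i "Suc j"] assms(2) by auto
qed (simp add: Y_def)

lemma tail_stable:
  assumes t: "t \<in> box" and "i \<in> {1..CARD('m)}" and "i \<le> j" "j \<le> CARD('m)"
  shows "Y j t $ Inr (e i) = Y i t $ Inr (e i)"
  using assms(3,4)
proof (induction j rule: dec_induct)
  case (step j)
  then show ?case
    using tail_step[OF t, of "Suc j" "e i"] e_eq_iff[of i "Suc j"] assms(2) by auto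
qed simp

section \<open>Injectivity and rank from the triangular structure\<close>

text \<open>The times are recovered one after another. The final coordinate \<open>e j\<close> is
  that of stage \<open>j\<close>, and once the earlier times agree it is an injective function of
  the \<open>j\<close>-th time.\<close>

lemma inj_on_Y: "inj_on (Y CARD('m)) box"
proof (rule inj_onI)
  fix t t' assume t: "t \<in> box" and t': "t' \<in> box" and eq: "Y CARD('m) t = Y CARD('m) t'"
  have "t $ e j = t' $ e j" if "j \<in> {1..CARD('m)}" for j
    using that
  proof (induction j rule: less_induct)
    case (less j)
    note j = less.prems
    define \<zeta> where "\<zeta> = (\<lambda>r. Y j (upd t (e j) r) $ Inr (e j))"
    \<comment> \<open>Earlier times agree by induction, so both stage \<open>j\<close> points lie on
      the same path.\<close>
    have "Y j t' = Y j (upd t (e j) (t' $ e j))"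
    proof (rule Y_prefix)
      fix i assume i: "i \<in> {1..j}"
      then have "i = j \<or> i < j" by auto
      with i j less.IH[of i] e_eq_iff[of i j] show "t' $ e i = upd t (e j) (t' $ e j) $ e i" by auto
    qed
    then have \<zeta>: "\<zeta> (t $ e j) = \<zeta> (t' $ e j)"
      using tail_stable[OF t j, of "CARD('m)"] tail_stable[OF t' j, of "CARD('m)"] j eq
      by (simp add: \<zeta>_def)
    \<comment> \<open>By the mean value theorem, equal values at distinct times would force
      \<open>Delta F\<close> to vanish in between.\<close>
    have inj: "\<zeta> p \<noteq> \<zeta> q" if pq: "p \<in> {a j..b j}" "q \<in> {a j..b j}" "p < q" for p q
    proof
      assume "\<zeta> p = \<zeta> q"
      moreover have d: "(\<zeta> has_derivative (\<lambda>h. h * Delta F (Y j (upd t (e j) r)))) (at r within {p..q})"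
        if "p \<le> r" "r \<le> q" for r
        using tail_path_derivative[OF t j, of r "e j"] that pq
        unfolding \<zeta>_def has_vector_derivative_def
        by (auto intro: has_derivative_subset)
      ultimately obtain r where r: "p < r" "r < q" "(q - p) * Delta F (Y j (upd t (e j) r)) = 0"
        using mvt_simple[OF pq(3) d] by fastforce
      then have "r \<in> {a j..b j}" using pq by auto
      from Delta_nonzero[OF Y_in_V[OF upd_in_box[OF t j this] j]] r show False by simp
    qed
    show ?case
      using inj[OF box_coord[OF t j] box_coord[OF t' j]] inj[OF box_coord[OF t' j] box_coord[OF t j]] \<zeta>
      by (metis linorder_neqE_linordered_idom)
  qed
  then have "t $ s = t' $ s" for s
    using obtain_index[of s] by blast
  then show "t = t'" by (simp add: vec_eq_iff)
qed

text \<open>In the order given by \<open>e\<close>, the tail rows of the derivative form a lower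
  triangular matrix with diagonal entries \<open>Delta F (Y j t)\<close>, so the derivative is
  injective.\<close>

lemma regular_at_Y:
  assumes t: "t \<in> box" and diff: "Y CARD('m) differentiable (at t within box)"
  shows "regular_at (Y CARD('m)) box t"
proof -
  define D where "D = frechet_derivative (Y CARD('m)) (at t within box)"
  have D: "(Y CARD('m) has_derivative D) (at t within box)"
    using diff unfolding D_def frechet_derivative_works .
  have lin: "linear D"
    using D has_derivative_bounded_linear bounded_linear.linear by blast
  have D_axis: "D (axis (e j) 1) $ Inr (e i) = (if i = j then Delta F (Y j t) else 0)"
    if i: "i \<in> {1..CARD('m)}" and j: "j \<in> {1..CARD('m)}" and "i \<le> j" for i j
  proof -
    have "((\<lambda>r. Y CARD('m) (upd t (e j) r)) has_derivative (\<lambda>h. D (h *\<^sub>R axis (e j) 1)))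
        (at (t $ e j) within {a j..b j})"
    proof (rule has_derivative_in_compose[where f = "upd t (e j)" and g = "Y CARD('m)"])
      show "(Y CARD('m) has_derivative D) (at (upd t (e j) (t $ e j)) within upd t (e j) ` {a j..b j})"
        using D upd_in_box[OF t j] by (auto intro: has_derivative_subset)
      show "(upd t (e j) has_derivative (\<lambda>h. h *\<^sub>R axis (e j) 1)) (at (t $ e j) within {a j..b j})"
        using upd_has_vector_derivative unfolding has_vector_derivative_def .
    qed
    from bounded_linear.has_derivative[OF bounded_linear_vec_nth this, of "Inr (e i)"]
    have "((\<lambda>r. Y CARD('m) (upd t (e j) r) $ Inr (e i)) has_vector_derivative
        D (axis (e j) 1) $ Inr (e i)) (at (t $ e j) within {a j..b j})"
      by (simp add: has_vector_derivative_def linear_scale[OF lin])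
    \<comment> \<open>For \<open>i \<le> j\<close> the coordinate \<open>e i\<close> no longer
      changes after stage \<open>j\<close>, so the final map may be replaced by
      \<open>Y j\<close>.\<close>
    moreover have "((\<lambda>r. Y CARD('m) (upd t (e j) r) $ Inr (e i)) has_vector_derivative
        (if i = j then Delta F (Y j t) else 0)) (at (t $ e j) within {a j..b j})"
    proof (rule has_vector_derivative_transform[OF box_coord[OF t j]])
      show "((\<lambda>r. Y j (upd t (e j) r) $ Inr (e i)) has_vector_derivative
          (if i = j then Delta F (Y j t) else 0)) (at (t $ e j) within {a j..b j})"
        using tail_path_derivative[OF t j box_coord[OF t j], of "e i"] e_eq_iff[OF i j]
        by (cases "i = j") auto
      show "Y CARD('m) (upd t (e j) r) $ Inr (e i) = Y j (upd t (e j) r) $ Inr (e i)"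
        if "r \<in> {a j..b j}" for r
        using tail_stable[OF upd_in_box[OF t j that] i, of "CARD('m)"]
          tail_stable[OF upd_in_box[OF t j that] i \<open>i \<le> j\<close>] \<open>i \<le> j\<close> j by simp
    qed
    \<comment> \<open>The interval is nondegenerate, so the derivative within it is unique at its
      end points too.\<close>
    ultimately show ?thesis
      using vector_derivative_unique_within[of "t $ e j" "{a j..b j}"] box_coord[OF t j] ab[OF j]
      by (auto simp: trivial_limit_within islimpt_Icc)
  qed
  \<comment> \<open>Forward substitution: in row \<open>e j\<close> the entries before the diagonal
    meet components of \<open>w\<close> already known to vanish, and the entries after it are
    zero.\<close>
  have "w = 0" if Dw: "D w = 0" for w
  proof -
    have "w $ e j = 0" if "j \<in> {1..CARD('m)}" for j
      using that
    proof (induction j rule: less_induct)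
      case (less j)
      note j = less.prems
      have "D w = (\<Sum>s\<in>UNIV. (w $ s) *\<^sub>R D (axis s 1))"
        using basis_expansion[of w] linear_sum[OF lin, of "\<lambda>s. (w $ s) *\<^sub>R axis s 1" UNIV]
        by (simp add: scalar_mult_eq_scaleR linear_scale[OF lin])
      then have "0 = (\<Sum>s\<in>UNIV. w $ s * D (axis s 1) $ Inr (e j))"
        using Dw by (simp add: vec_eq_iff)
      also have "\<dots> = (\<Sum>i\<in>{1..CARD('m)}. w $ e i * D (axis (e i) 1) $ Inr (e j))"
        by (rule sum.reindex_bij_betw[OF e, symmetric])
      also have "\<dots> = (\<Sum>i\<in>{1..CARD('m)}. if i = j then w $ e j * Delta F (Y j t) else 0)"
      proof (rule sum.cong[OF refl])
        fix i assume i: "i \<in> {1..CARD('m)}"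
        show "w $ e i * D (axis (e i) 1) $ Inr (e j) = (if i = j then w $ e j * Delta F (Y j t) else 0)"
          using less.IH[OF _ i] D_axis[OF j i] by (cases i j rule: linorder_cases) auto
      qed
      also have "\<dots> = w $ e j * Delta F (Y j t)"
        using j by simp
      finally show ?case
        using Delta_nonzero[OF Y_in_V[OF t j]] by simp
    qed
    then have "w $ s = 0" for s
      using obtain_index[of s] by blast
    then show ?thesis by (simp add: vec_eq_iff)
  qed
  moreover have "(*v) (jacobian (Y CARD('m)) (at t within box)) = D"
    using matrix_vector_mul(2)[OF lin] by (simp add: jacobian_def D_def)
  ultimately have "rank (jacobian (Y CARD('m)) (at t within box)) = CARD('m)"
    unfolding full_rank_injective using lin by (simp add: linear_injective_0)
  with diff show ?thesis by (simp add: regular_at_def)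
qed

section \<open>Confinement to the level set and to a ball\<close>

text \<open>The fields are orthogonal to \<open>gradient (F k)\<close>, so \<open>F k\<close> is
  constant along each stage and keeps its value at \<open>x0\<close>.\<close>

lemma F_Y_zero:
  assumes F: "C1_on (F k) V" "F k x0 = 0" and t: "t \<in> box" and j: "j \<le> CARD('m)"
  shows "F k (Y j t) = 0"
  using j
proof (induction j)
  case (Suc j)
  then have j: "Suc j \<in> {1..CARD('m)}" by auto
  let ?p = "\<lambda>r. Y (Suc j) (upd t (e (Suc j)) r)"
  have "((\<lambda>r. F k (?p r)) has_vector_derivative 0) (at r within {a (Suc j)..b (Suc j)})"
    if r: "r \<in> {a (Suc j)..b (Suc j)}" for r
  proof -
    have V: "?p r \<in> V" by (rule Y_in_V[OF upd_in_box[OF t j r] j])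
    from has_derivative_compose[OF Y_path_derivative[OF t j r, unfolded has_vector_derivative_def]
        C1_on_has_derivative[OF F(1) V]]
    show ?thesis
      using vfield_spec(1)[OF Delta_nonzero[OF V], of "e (Suc j)" k]
      by (simp add: has_vector_derivative_def inner_commute)
  qed
  then obtain c where c: "\<And>r. r \<in> {a (Suc j)..b (Suc j)} \<Longrightarrow> F k (?p r) = c"
    using has_vector_derivative_zero_constant[of "{a (Suc j)..b (Suc j)}" "\<lambda>r. F k (?p r)"] by auto
  have "F k (?p 0) = 0"
    using Suc Y_zero[OF t j] by simp
  with c[of 0] c[OF box_coord[OF t j]] ab[OF j] show ?case by simp
qed (simp add: Y_def F)

text \<open>Each stage lasts at most \<open>\<delta>\<close> at speed at most \<open>K\<close>,
  hence adds at most \<open>K * \<delta>\<close> to the distance from \<open>x0\<close>.\<close>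

lemma Y_in_ball:
  fixes R K \<delta> :: real
  assumes bound: "\<And>s x. x \<in> ball x0 R \<Longrightarrow> norm (vfield F s x) \<le> K"
    and \<delta>: "\<And>j. j \<in> {1..CARD('m)} \<Longrightarrow> - \<delta> < a j \<and> b j < \<delta>"
    and K: "0 \<le> K" "CARD('m) * (K * \<delta>) < R" and t: "t \<in> box" and j: "j \<le> CARD('m)"
  shows "Y j t \<in> ball x0 R"
proof -
  have "\<delta> > 0" using \<delta>[of 1] ab[of 1] by force
  have R: "real j * (K * \<delta>) < R" if "j \<le> CARD('m)" for j
    using K \<open>\<delta> > 0\<close> that by (intro le_less_trans[OF _ K(2)] mult_right_mono) auto
  have "dist x0 (Y j t) \<le> j * (K * \<delta>)"
    using j
  proof (induction j)
    case (Suc j)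
    then have j: "Suc j \<in> {1..CARD('m)}" by auto
    define r where "r = t $ e (Suc j)"
    have r: "r \<in> {a (Suc j)..b (Suc j)}"
      unfolding r_def by (rule box_coord[OF t j])
    then have rd: "\<bar>r\<bar> \<le> \<delta>" using \<delta>[OF j] by auto
    define p where "p \<tau> = Y (Suc j) (upd t (e (Suc j)) \<tau>)" for \<tau>
    have sr: "s * r \<in> {a (Suc j)..b (Suc j)}" if "s \<in> {0..1}" for s
    proof -
      have "closed_segment 0 r \<subseteq> {a (Suc j)..b (Suc j)}"
        by (rule closed_segment_subset) (use r ab[OF j] in auto)
      moreover have "s * r \<in> closed_segment 0 r"
        using that by (auto simp: closed_segment_def)
      ultimately show ?thesis by blast
    qed
    \<comment> \<open>Scaling time by \<open>r\<close> runs the stage over \<open>{0..1}\<close>,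
      with \<open>r\<close> of either sign.\<close>
    have "dist x0 (p (1 * r)) \<le> dist x0 (p (0 * r)) + K * \<delta>"
    proof (rule norm_growth_within_ball[where q = "\<lambda>s. p (s * r)"])
      fix s :: real assume s: "s \<in> {0..1}"
      have "((\<lambda>s. s * r) has_vector_derivative r) (at s within {0..1})"
        by (auto intro!: derivative_eq_intros)
      moreover have "(p has_vector_derivative vfield F (e (Suc j)) (p (s * r)))
          (at (s * r) within (\<lambda>s. s * r) ` {0..1})"
        using Y_path_derivative[OF t j sr[OF s]] sr unfolding p_def
        by (auto intro: has_vector_derivative_within_subset)
      ultimately show "((\<lambda>s. p (s * r)) has_vector_derivative r *\<^sub>R vfield F (e (Suc j)) (p (s * r)))
          (at s within {0..1})"
        using vector_diff_chain_within by (fastforce simp: o_def)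
      assume "p (s * r) \<in> ball x0 R"
      then show "norm (r *\<^sub>R vfield F (e (Suc j)) (p (s * r))) \<le> K * \<delta>"
        using mult_mono[OF rd bound] \<open>\<delta> > 0\<close> by (simp add: mult.commute)
    next
      show "dist x0 (p (0 * r)) + K * \<delta> < R"
        using Suc Y_zero[OF t j] R[of "Suc j"] by (simp add: p_def algebra_simps)
    qed (use K \<open>\<delta> > 0\<close> in auto)
    then show ?case
      using Suc Y_zero[OF t j] by (simp add: p_def r_def algebra_simps)
  qed (simp add: Y_def)
  with R[OF j] show ?thesis by simp
qed

section \<open>Recovering the times from the final tail\<close>

text \<open>While stage \<open>j\<close> runs, earlier tail coordinates have their final values and
  later ones their initial values; the weights 1, \<open>u\<close> and 0 in \<open>d\<close> encode
  this. The moving coordinate solves a separable equation, so its elapsed time is the integral of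
  the reciprocal speed.\<close>

lemma time_map_Y:
  fixes h :: "real ^ 'm \<Rightarrow> real" and \<rho> :: real
  defines "idx \<equiv> inv_into {1..CARD('m)} e" and "c \<equiv> tail x0"
  defines "d \<equiv> \<lambda>s i u. if idx i < idx s then 1 else if i = s then u else 0"
  assumes cont: "continuous_on A h" and nz: "\<And>z. z \<in> A \<Longrightarrow> h z \<noteq> 0"
    and Y_h: "\<And>j t. j \<le> CARD('m) \<Longrightarrow> t \<in> box \<Longrightarrow> tail (Y j t) \<in> A \<and> h (tail (Y j t)) = Delta F (Y j t)"
    and t: "t \<in> box"
  defines "z \<equiv> tail (Y CARD('m) t)"
  shows "(\<chi> s. (z $ s - c $ s) *
    integral {0..1} (\<lambda>u. inverse (h (\<chi> i. c $ i + d s i u * (z $ i - c $ i))))) = t"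
proof -
  have idx: "idx (e i) = i" if "i \<in> {1..CARD('m)}" for i
    unfolding idx_def using e that by (simp add: bij_betw_def)
  have "(z $ e j - c $ e j) *
    integral {0..1} (\<lambda>u. inverse (h (\<chi> i. c $ i + d (e j) i u * (z $ i - c $ i)))) = t $ e j"
    if j: "j \<in> {1..CARD('m)}" for j
  proof -
    \<comment> \<open>The tail during stage \<open>j\<close> as a function of its moving coordinate
      alone.\<close>
    define \<kappa> where "\<kappa> \<xi> = (\<chi> i. if idx i < j then z $ i else if i = e j then \<xi> else c $ i)" for \<xi>
    define \<zeta> where "\<zeta> = (\<lambda>r. Y j (upd t (e j) r) $ Inr (e j))"
    have \<kappa>: "\<kappa> (\<zeta> r) = tail (Y j (upd t (e j) r))" if r: "r \<in> {a j..b j}" for r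
    proof -
      have "\<kappa> (\<zeta> r) $ e i = tail (Y j (upd t (e j) r)) $ e i" if i: "i \<in> {1..CARD('m)}" for i
      proof (cases i j rule: linorder_cases)
        case less
        have "Y i t = Y i (upd t (e j) r)"
          using less i j by (intro Y_prefix) (auto simp: e_eq_iff)
        then show ?thesis
          using less idx[OF i] i j tail_stable[OF t i, of "CARD('m)"]
            tail_stable[OF upd_in_box[OF t j r] i, of j]
          by (simp add: \<kappa>_def z_def)
      next
        case equal
        then show ?thesis using idx[OF i] by (simp add: \<kappa>_def \<zeta>_def)
      next
        case greater
        then show ?thesis
          using idx[OF i] tail_initial[OF upd_in_box[OF t j r] i, of j] e_eq_iff[OF i j]
          by (simp add: \<kappa>_def c_def)
      qed
      then have "\<kappa> (\<zeta> r) $ s = tail (Y j (upd t (e j) r)) $ s" for s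
        using obtain_index[of s] by metis
      then show ?thesis by (simp add: vec_eq_iff)
    qed
    have hY: "\<kappa> (\<zeta> r) \<in> A" "h (\<kappa> (\<zeta> r)) = Delta F (Y j (upd t (e j) r))" if "r \<in> {a j..b j}" for r
      using Y_h[OF _ upd_in_box[OF t j that], of j] j by (auto simp: \<kappa>[OF that])
    have "(\<zeta> (t $ e j) - \<zeta> 0) *
        integral {0..1} (\<lambda>u. inverse (h (\<kappa> (\<zeta> 0 + u * (\<zeta> (t $ e j) - \<zeta> 0))))) = t $ e j"
    proof (rule integral_reciprocal_speed[OF _ _ box_coord[OF t j]])
      show "(\<zeta> has_vector_derivative h (\<kappa> (\<zeta> r))) (at r within {a j..b j})" if "r \<in> {a j..b j}" for r
        using tail_path_derivative[OF t j that, of "e j"] hY[OF that] by (simp add: \<zeta>_def)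
      show "continuous_on (\<zeta> ` {a j..b j}) (\<lambda>\<xi>. h (\<kappa> \<xi>))"
      proof (rule continuous_on_compose2[OF cont])
        show "continuous_on (\<zeta> ` {a j..b j}) \<kappa>"
          unfolding \<kappa>_def
        proof (rule continuous_on_vec_lambda)
          show "continuous_on (\<zeta> ` {a j..b j}) (\<lambda>\<xi>. if idx i < j then z $ i else if i = e j then \<xi> else c $ i)" for i
            by (cases "idx i < j"; cases "i = e j") auto
        qed
      qed (use hY in auto)
      show "h (\<kappa> (\<zeta> r)) \<noteq> 0" if "r \<in> {a j..b j}" for r
        by (rule nz[OF hY(1)[OF that]])
    qed (use ab[OF j] in auto)
    moreover have "\<zeta> 0 = c $ e j"
      using Y_zero[OF t j] tail_initial[OF t j, of "j - 1"] j by (simp add: \<zeta>_def c_def)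
    moreover have "\<zeta> (t $ e j) = z $ e j"
      using tail_stable[OF t j, of "CARD('m)"] j by (simp add: \<zeta>_def z_def)
    moreover have "\<kappa> (c $ e j + u * (z $ e j - c $ e j)) = (\<chi> i. c $ i + d (e j) i u * (z $ i - c $ i))" for u
      using idx[OF j] by (auto simp: \<kappa>_def d_def vec_eq_iff)
    ultimately show ?thesis by simp
  qed
  then have "(z $ s - c $ s) *
    integral {0..1} (\<lambda>u. inverse (h (\<chi> i. c $ i + d s i u * (z $ i - c $ i)))) = t $ s" for s
    using obtain_index[of s] by blast
  then show ?thesis
    by (simp add: vec_eq_iff)
qed

end


section \<open>Choice of the interval size and conclusion\<close>

text \<open>The fields are built from first derivatives of \<open>F\<close>, so for \<open>F\<close>
  of class C1 they are continuous but need not be C1. Full rank is therefore asserted wherever the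
  final map is differentiable, and at every point when the fields are C1.\<close>

theorem theorem5:
  fixes \<Omega> V :: "(real ^ ('l::finite + 'm::finite)) set"
    and x0 :: "real ^ ('l + 'm)"
    and F :: "'l \<Rightarrow> real ^ ('l + 'm) \<Rightarrow> real"
    and e :: "nat \<Rightarrow> 'm"
  assumes "open \<Omega>" and "connected \<Omega>" and "bounded \<Omega>" and "x0 \<in> \<Omega>"
    and "\<And>k. C1_on (F k) \<Omega>" and "\<And>k. F k x0 = 0"
    and "Delta F x0 \<noteq> 0"
    and "open V" and "V \<subseteq> \<Omega>" and "x0 \<in> V" and "\<And>x. x \<in> V \<Longrightarrow> Delta F x \<noteq> 0"
    and "bij_betw e {1..CARD('m)} UNIV"
  shows "\<exists>\<delta>>0. \<forall>(a :: nat \<Rightarrow> real) (b :: nat \<Rightarrow> real) y.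
    (\<forall>j\<in>{1..CARD('m)}. - \<delta> < a j \<and> a j < 0 \<and> 0 < b j \<and> b j < \<delta>) \<longrightarrow>
    iterated_solution CARD('m) (\<lambda>j. vfield F (e j)) V x0 (\<lambda>j. {a j..b j}) y \<longrightarrow>
    (let B = box_of e (\<lambda>j. {a j..b j}); f = on_vec e (y CARD('m)) in
       inj_on f B \<and>
       (\<forall>t\<in>B. f differentiable (at t within B) \<longrightarrow> regular_at f B t) \<and>
       ((\<forall>s i. C1_on (\<lambda>x. vfield F s x $ i) V) \<longrightarrow> (\<forall>t\<in>B. regular_at f B t)))"
proof -
  have box: "iterated_solution_box F V x0 e a b y"
    if "\<forall>j\<in>{1..CARD('m)}. - \<delta> < a j \<and> a j < 0 \<and> 0 < b j \<and> b j < \<delta>"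
      "iterated_solution CARD('m) (\<lambda>j. vfield F (e j)) V x0 (\<lambda>j. {a j..b j}) y" for \<delta> a b y
    using that assms by unfold_locales auto
  \<comment> \<open>\<open>\<delta>\<close> is chosen for differentiability; injectivity and the
    rank then come from the triangular structure on the same box.\<close>
  have "\<exists>\<delta>>0. \<forall>(a :: nat \<Rightarrow> real) (b :: nat \<Rightarrow> real) y.
    (\<forall>j\<in>{1..CARD('m)}. - \<delta> < a j \<and> a j < 0 \<and> 0 < b j \<and> b j < \<delta>) \<longrightarrow>
    iterated_solution CARD('m) (\<lambda>j. vfield F (e j)) V x0 (\<lambda>j. {a j..b j}) y \<longrightarrow>
    (\<forall>s i. C1_on (\<lambda>x. vfield F s x $ i) V) \<longrightarrow>
    (\<forall>t\<in>box_of e (\<lambda>j. {a j..b j}).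
      on_vec e (y CARD('m)) differentiable (at t within box_of e (\<lambda>j. {a j..b j})))"
  proof (cases "\<forall>s i. C1_on (\<lambda>x. vfield F s x $ i) V")
    case C1: True
    define c where "c = tail x0"
    define idx where "idx = inv_into {1..CARD('m)} e"
    define d where "d s i u = (if idx i < idx s then 1 else if i = s then u else 0)" for s i :: 'm and u :: real
    have F: "C1_on (F k) V" for k
      using C1_on_subset assms by blast
    obtain s0 :: 'm where True by simp
    \<comment> \<open>\<open>Delta F\<close> is itself a coordinate of a field on \<open>V\<close>,
      so it inherits the C1 property.\<close>
    have Delta: "C1_on (Delta F) V"
      by (rule C1_on_cong[OF \<open>open V\<close> C1[rule_format, of s0 "Inr s0"]])
        (simp add: vfield_spec(2) assms(11))
    obtain U W \<Phi> where U: "open U" "x0 \<in> U" and W: "open W" "tail x0 \<in> W" and \<Phi>V: "\<Phi> ` W \<subseteq> V"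
      and \<Phi>: "\<And>x. x \<in> U \<Longrightarrow> \<forall>k. F k x = 0 \<Longrightarrow> \<Phi> (tail x) = x"
      and \<Phi>_C1: "\<And>i. C1_on (\<lambda>z. \<Phi> z $ i) W"
      by (rule level_set_graph[OF \<open>open V\<close> \<open>x0 \<in> V\<close> F assms(6,7)]) (rule that)
    \<comment> \<open>On the level set the speed is a function of the tail alone.\<close>
    define h where "h z = Delta F (\<Phi> z)" for z
    have h_C1: "C1_on h W"
      unfolding h_def by (rule C1_on_compose[OF Delta \<Phi>_C1 \<Phi>V])
    obtain \<rho> where \<rho>: "\<rho> > 0" "ball c \<rho> \<subseteq> W"
      using W open_contains_ball unfolding c_def by blast
    have h_nz: "h z \<noteq> 0" if "z \<in> ball c \<rho>" for z
      unfolding h_def by (rule assms(11)) (use that \<rho> \<Phi>V in blast)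
    define T where "T z = (\<chi> s. (z $ s - c $ s) *
      integral {0..1} (\<lambda>u. inverse (h (\<chi> i. c $ i + d s i u * (z $ i - c $ i)))))" for z
    have d: "continuous_on {0..1} (d s i)" "u \<in> {0..1} \<Longrightarrow> d s i u \<in> {0..1}" for s i u
      by (cases "idx i < idx s"; cases "i = s"; auto simp: d_def[abs_def])+
    obtain N Q S where N: "open N" "c \<in> N" "N \<subseteq> ball c \<rho>" and Q: "open Q"
      and T: "\<forall>z\<in>N. T z \<in> Q \<and> S (T z) = z" and S_C1: "\<And>i. C1_on (\<lambda>t. S t $ i) Q"
      by (rule time_map_local_inverse[where d = d, OF C1_on_subset[OF h_C1 \<rho>(2)] h_nz \<rho>(1) d,
            folded T_def]) (assumption+, rule that)
    have "continuous_on UNIV (tail :: real ^ ('l + 'm) \<Rightarrow> _)"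
      by (intro continuous_intros)
    then have "open (U \<inter> V \<inter> tail -` N)"
      using U N \<open>open V\<close> by (intro open_Int) (auto simp: continuous_on_open_vimage)
    \<comment> \<open>In this ball the graph representation, the bound on the fields and the local
      inverse of \<open>T\<close> are all available.\<close>
    then obtain R where R: "R > 0" "cball x0 R \<subseteq> U \<inter> V \<inter> tail -` N"
      using U N \<open>x0 \<in> V\<close> unfolding c_def by (metis IntI open_contains_cball vimageI)
    have "continuous_on (cball x0 R) (vfield F s)" for s
    proof -
      have "continuous_on V (\<lambda>x. vfield F s x $ i)" for i
        using C1 C1_on_continuous_on by blast
      then have "continuous_on V (vfield F s)"
        by (auto simp: continuous_on_componentwise[of _ "vfield F s"] Basis_vec_def inner_axis)
      then show ?thesis using R by (auto intro: continuous_on_subset)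
    qed
    then have "bounded (vfield F s ` cball x0 R)" for s
      by (intro compact_imp_bounded compact_continuous_image) auto
    then have "bounded (\<Union>s. vfield F s ` cball x0 R)"
      by (intro bounded_UN) auto
    then obtain K where K: "K > 0" "\<And>s x. x \<in> cball x0 R \<Longrightarrow> norm (vfield F s x) \<le> K"
      unfolding bounded_pos by blast
    \<comment> \<open>The summand 1 makes \<open>CARD('m) * (K * \<delta>)\<close> strictly less
      than \<open>R\<close>.\<close>
    define \<delta> where "\<delta> = R / (CARD('m) * K + 1)"
    have den: "real CARD('m) * K + 1 > 0" using K by (simp add: add_pos_pos)
    then have \<delta>: "\<delta> > 0" "CARD('m) * (K * \<delta>) < R"
      using R K by (auto simp: \<delta>_def field_simps)
    show ?thesis
    proof (intro exI[of _ \<delta>] conjI allI impI ballI \<delta>(1))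
      fix a b y t
      assume small: "\<forall>j\<in>{1..CARD('m)}. - \<delta> < a j \<and> a j < 0 \<and> 0 < b j \<and> b j < \<delta>"
        and y: "iterated_solution CARD('m) (\<lambda>j. vfield F (e j)) V x0 (\<lambda>j. {a j..b j}) y"
        and t: "t \<in> box_of e (\<lambda>j. {a j..b j})"
      interpret iterated_solution_box F V x0 e a b y
        by (rule box[OF small y])
      have Y: "Y j t \<in> U \<and> tail (Y j t) \<in> N \<and> \<Phi> (tail (Y j t)) = Y j t"
        if "t \<in> box" "j \<le> CARD('m)" for j t
      proof -
        have "Y j t \<in> ball x0 R"
          by (rule Y_in_ball[OF K(2) _ _ \<delta>(2) that]) (use small K in auto)
        then have "Y j t \<in> U \<inter> V \<inter> tail -` N"
          using R(2) ball_subset_cball by blast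
        then have "Y j t \<in> U \<and> tail (Y j t) \<in> N" by simp
        then show ?thesis
          using \<Phi> F_Y_zero[OF F assms(6) that] by blast
      qed
      \<comment> \<open>\<open>T\<close> sends the final tail to \<open>t\<close> and
        \<open>S\<close> inverts \<open>T\<close> on \<open>N\<close>, so the final map is
        \<open>\<Phi>\<close> after \<open>S\<close> on the box.\<close>
      have *: "Y CARD('m) t = \<Phi> (S t) \<and> t \<in> Q \<and> S t \<in> W" if t: "t \<in> box" for t
      proof -
        have "T (tail (Y CARD('m) t)) = t"
          unfolding T_def c_def d_def idx_def
        proof (rule time_map_Y[OF _ h_nz _ t])
          show "continuous_on (ball c \<rho>) h"
            using C1_on_continuous_on C1_on_subset[OF h_C1 \<rho>(2)] by blast
          show "tail (Y j t) \<in> ball c \<rho> \<and> h (tail (Y j t)) = Delta F (Y j t)"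
            if "j \<le> CARD('m)" "t \<in> box" for j t
            using Y[OF that(2,1)] N by (auto simp: h_def)
        qed
        moreover have z: "tail (Y CARD('m) t) \<in> N" "\<Phi> (tail (Y CARD('m) t)) = Y CARD('m) t"
          using Y[OF t order_refl] by auto
        ultimately have "t \<in> Q" "S t = tail (Y CARD('m) t)"
          using T by auto
        moreover have "tail (Y CARD('m) t) \<in> W" using z(1) N(3) \<rho>(2) by blast
        ultimately show ?thesis using z(2) by simp
      qed
      \<comment> \<open>\<open>Q\<close> and \<open>W\<close> are open, so both maps have two-sided
        derivatives even when \<open>t\<close> is on the boundary of the box.\<close>
      have "t \<in> Q" "S t \<in> W" using *[OF t] by auto
      then have "S differentiable (at t)" "\<Phi> differentiable (at (S t))"
        using differentiableI[OF C1_on_components_has_derivative[OF S_C1]]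
          differentiableI[OF C1_on_components_has_derivative[OF \<Phi>_C1]] by blast+
      then have "(\<lambda>t. \<Phi> (S t)) differentiable (at t within box)"
        by (blast intro: differentiable_compose[of \<Phi> S] differentiable_at_withinI)
      then show "on_vec e (y CARD('m)) differentiable (at t within box)"
        unfolding on_vec_eq_Y
        by (rule differentiable_transform_within[OF _ zero_less_one t]) (use * in auto)
    qed
  \<comment> \<open>If the fields are not C1, the claim is vacuous and any positive
    \<open>\<delta>\<close> serves.\<close>
  qed (auto intro: exI[of _ 1])
  then obtain \<delta> where "\<delta> > 0" and diff: "\<And>a b y. \<lbrakk>\<forall>j\<in>{1..CARD('m)}. - \<delta> < a j \<and> a j < 0 \<and> 0 < b j \<and> b j < \<delta>;
    iterated_solution CARD('m) (\<lambda>j. vfield F (e j)) V x0 (\<lambda>j. {a j..b j}) y;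
    \<forall>s i. C1_on (\<lambda>x. vfield F s x $ i) V\<rbrakk> \<Longrightarrow>
    \<forall>t\<in>box_of e (\<lambda>j. {a j..b j}).
      on_vec e (y CARD('m)) differentiable (at t within box_of e (\<lambda>j. {a j..b j}))"
    by blast
  show ?thesis
  proof (intro exI[of _ \<delta>] conjI allI impI \<open>\<delta> > 0\<close>)
    fix a b y
    assume small: "\<forall>j\<in>{1..CARD('m)}. - \<delta> < a j \<and> a j < 0 \<and> 0 < b j \<and> b j < \<delta>"
      and y: "iterated_solution CARD('m) (\<lambda>j. vfield F (e j)) V x0 (\<lambda>j. {a j..b j}) y"
    interpret iterated_solution_box F V x0 e a b y
      by (rule box[OF small y])
    show "let B = box_of e (\<lambda>j. {a j..b j}); f = on_vec e (y CARD('m)) in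
       inj_on f B \<and>
       (\<forall>t\<in>B. f differentiable (at t within B) \<longrightarrow> regular_at f B t) \<and>
       ((\<forall>s i. C1_on (\<lambda>x. vfield F s x $ i) V) \<longrightarrow> (\<forall>t\<in>B. regular_at f B t))"
      using diff[OF small y] inj_on_Y regular_at_Y unfolding Let_def on_vec_eq_Y by blast
  qed
qed

end
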